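(* Let $x_1,\dots,x_n\in\mathcal{X}$, $y_1,\dots,y_n\in\{-1,+1\}$, let $f_{t-1}:\mathcal{X}\to\mathbb{R}$ be the current ensemble, and let $q^t\in\Delta_n$ be the exponential-weights distribution it induces. Let $w^t=\arg\min_{w\in\mathcal{C}_\epsilon}\mathrm{KL}(w\|q^t)$ be the projection of $q^t$ onto the fairness constraint set $\mathcal{C}_\epsilon$. If $h_t:\mathcal{X}\to\{-1,+1\}$ achieves edge $\gamma_t^{(w)}:=\gamma(w^t)$ under $w^t$, then its edge $\gamma_t^{(q)}:=\gamma(q^t)$ under $q^t$ satisfies $$\gamma_t^{(q)}\ge\gamma_t^{(w)}-\delta_t,\qquad\text{where }\ \delta_t=\sqrt{\tfrac12\,\mathrm{KL}(w^t\,\|\,q^t)}.$$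
   Context: $[n]=\{1,\dots,n\}$ and $\Delta_n=\{p\in\mathbb{R}^n:p_i\ge0,\ \sum_i p_i=1\}$. The edge of $h_t$ under $p\in\Delta_n$ is $\gamma(p)=\frac12\sum_{i=1}^n p_i\,y_i h_t(x_i)=\frac12-\sum_{i=1}^n p_i\,\mathbf{1}[y_i\neq h_t(x_i)]$. The exponential-weights distribution induced by $f_{t-1}=\sum_{s=1}^{t-1}\alpha_s h_s$ (with real $\alpha_s>0$, $h_s:\mathcal{X}\to\{-1,+1\}$, $f_0\equiv0$) is $q_i^t=\exp(-y_if_{t-1}(x_i))/\sum_{j=1}^n\exp(-y_jf_{t-1}(x_j))$. $\mathrm{KL}(p\|q)=\sum_i p_i\log(p_i/q_i)$ (natural logarithm, $0\log0=0$). For bounded features $g=(g_1,\dots,g_K):[n]\to\mathbb{R}^K$ and slack $\epsilon>0$, the fairness constraint set is $\mathcal{C}_\epsilon=\{w\in\Delta_n:\ |\sum_{i=1}^n w_ig_k(i)|\le\epsilon\ \ \forall k\in[K]\}$, understood to be nonempty so that the projection exists. *)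

theory Defs
  imports "HOL-Analysis.Analysis"
begin

text \<open>The index set \<open>[n]\<close> is a finite type \<open>'n\<close>, so that \<open>n = CARD('n)\<close>.\<close>

definition simplex_vectors :: "(real ^ 'n) set" where
  "simplex_vectors = {p. (\<forall>i. 0 \<le> p $ i) \<and> (\<Sum>i\<in>UNIV. p $ i) = 1}"

definition edge :: "('n::finite \<Rightarrow> 'x) \<Rightarrow> ('n \<Rightarrow> real) \<Rightarrow> ('x \<Rightarrow> real) \<Rightarrow> real ^ 'n \<Rightarrow> real" where
  "edge x y h p = 1/2 * (\<Sum>i\<in>UNIV. p $ i * y i * h (x i))"

lemma edge_eq_half_minus_error:
  assumes "p \<in> simplex_vectors" "\<And>i. y i \<in> {-1, 1}" "\<And>z. h z \<in> {-1, 1}"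
  shows "edge x y h p = 1/2 - (\<Sum>i\<in>UNIV. p $ i * of_bool (y i \<noteq> h (x i)))"
proof -
  have "p $ i * y i * h (x i) = p $ i - 2 * (p $ i * of_bool (y i \<noteq> h (x i)))" for i
    using assms(2)[of i] assms(3)[of "x i"] by auto
  then show ?thesis
    using assms(1)
    by (simp add: edge_def simplex_vectors_def sum_subtractf flip: sum_distrib_left)
qed

definition ensemble :: "(nat \<Rightarrow> real) \<Rightarrow> (nat \<Rightarrow> 'x \<Rightarrow> real) \<Rightarrow> nat \<Rightarrow> 'x \<Rightarrow> real" where
  "ensemble \<alpha> h t z = (\<Sum>s=1..t. \<alpha> s * h s z)"

definition exp_weights :: "('n::finite \<Rightarrow> 'x) \<Rightarrow> ('n \<Rightarrow> real) \<Rightarrow> ('x \<Rightarrow> real) \<Rightarrow> real ^ 'n" where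
  "exp_weights x y f = (\<chi> i. exp (- y i * f (x i)) / (\<Sum>j\<in>UNIV. exp (- y j * f (x j))))"

lemma exp_weights_pos: "0 < exp_weights x y f $ i"
  by (auto simp: exp_weights_def intro!: divide_pos_pos sum_pos)

lemma exp_weights_in_simplex: "exp_weights x y f \<in> simplex_vectors"
proof -
  have "(\<Sum>j\<in>UNIV. exp (- y j * f (x j))) > 0"
    by (intro sum_pos) auto
  then show ?thesis
    using exp_weights_pos[of x y f]
    by (auto simp: simplex_vectors_def exp_weights_def less_imp_le simp flip: sum_divide_distrib)
qed

text \<open>The convention \<open>0 log 0 = 0\<close> holds automatically. The value \<open>\<infinity>\<close> usually assigned when
  \<open>p\<^sub>i > 0 = q\<^sub>i\<close> is not represented: the definition is meant for \<open>q\<close> with positive entries,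
  such as \<open>exp_weights\<close>.\<close>

definition kl :: "real ^ 'n \<Rightarrow> real ^ 'n \<Rightarrow> real" where
  "kl p q = (\<Sum>i\<in>UNIV. p $ i * ln (p $ i / q $ i))"

definition fairness_set :: "nat \<Rightarrow> (nat \<Rightarrow> 'n::finite \<Rightarrow> real) \<Rightarrow> real \<Rightarrow> (real ^ 'n) set" where
  "fairness_set K g \<epsilon> =
    {w \<in> simplex_vectors. \<forall>k\<in>{1..K}. \<bar>\<Sum>i\<in>UNIV. w $ i * g k i\<bar> \<le> \<epsilon>}"

end

theory Submission
  imports Defs "HOL-Real_Asymp.Real_Asymp"
begin

text \<open>
  The edge is linear in the distribution with coefficients of absolute value at most \<open>1/2\<close>, so the
  two edges differ by at most the total variation distance, which Pinsker's inequality bounds.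
  Pinsker's inequality follows by Cauchy--Schwarz from the pointwise bound
  \<open>a ln (a / b) - a + b \<ge> 3 (a - b)\<^sup>2 / (2 (a + 2 b))\<close>. The projection exists since the divergence
  is continuous on the compact fairness set.
\<close>

text \<open>With u = a / b this is the pointwise bound of \<open>kl_summand_ge\<close> divided by a,
  which leaves one variable. The difference \<open>D\<close> of the two sides vanishes at 1, and its
  derivative has the sign of (v - 1)^3, so \<open>D\<close> decreases up to 1, increases afterwards
  and has its minimum 0 there.\<close>

lemma ln_ge_rational:
  fixes u :: real
  assumes "u > 0"
  shows "ln u \<ge> (u - 1) * (5 * u + 1) / (2 * u * (u + 2))"
proof -
  define D where "D v = ln v - (v - 1) * (5 * v + 1) / (2 * v * (v + 2))" for v :: real
  have der: "(D has_real_derivative (v - 1) ^ 3 / (v\<^sup>2 * (v + 2)\<^sup>2)) (at v)" if "v > 0" for v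
  proof -
    have "(D has_real_derivative 1 / v
        - ((10 * v - 4) * (2 * v * (v + 2)) - (v - 1) * (5 * v + 1) * (4 * v + 4))
          / (2 * v * (v + 2) * (2 * v * (v + 2)))) (at v)"
      unfolding D_def using that
      by (auto intro!: derivative_eq_intros)
    also have "1 / v - ((10 * v - 4) * (2 * v * (v + 2)) - (v - 1) * (5 * v + 1) * (4 * v + 4))
          / (2 * v * (v + 2) * (2 * v * (v + 2))) = (v - 1) ^ 3 / (v\<^sup>2 * (v + 2)\<^sup>2)"
      using that by (simp add: divide_simps) (simp add: algebra_simps power2_eq_square power3_eq_cube)
    finally show ?thesis .
  qed
  have "D u \<ge> D 1"
  proof (cases "u \<ge> 1")
    case True
    show ?thesis
    proof (rule DERIV_nonneg_imp_nondecreasing[OF True])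
      fix v :: real assume "1 \<le> v" "v \<le> u"
      then show "\<exists>d. (D has_real_derivative d) (at v) \<and> 0 \<le> d"
        by (intro exI[of _ "(v - 1) ^ 3 / (v\<^sup>2 * (v + 2)\<^sup>2)"] conjI der) auto
    qed
  next
    case False
    then have "u \<le> 1" by simp
    then show ?thesis
    proof (rule DERIV_nonpos_imp_nonincreasing)
      fix v :: real assume v: "u \<le> v" "v \<le> 1"
      have "(v - 1) ^ 3 \<le> 0"
        using v by (simp add: power_le_zero_eq)
      then show "\<exists>d. (D has_real_derivative d) (at v) \<and> d \<le> 0"
        using v assms
        by (intro exI[of _ "(v - 1) ^ 3 / (v\<^sup>2 * (v + 2)\<^sup>2)"] conjI der divide_nonpos_nonneg) auto
    qed
  qed
  then show ?thesis
    by (simp add: D_def)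
qed

text \<open>The correction - a + b sums to 0 over two probability vectors, so it leaves the total
  divergence unchanged while making every summand nonnegative. The denominators a + 2 b sum to 3, a
  constant that the Cauchy-Schwarz step can absorb.\<close>

lemma kl_summand_ge:
  fixes a b :: real
  assumes "a \<ge> 0" "b > 0"
  shows "a * ln (a / b) - a + b \<ge> 3/2 * ((a - b)\<^sup>2 / (a + 2 * b))"
proof (cases "a = 0")
  \<comment> \<open>The logarithm bound needs a / b > 0, so a = 0 is treated directly: the claim
    becomes b \<ge> 3/4 b.\<close>
  case True
  then show ?thesis
    using assms by (simp add: power2_eq_square)
next
  case False
  with assms have a: "a > 0" by simp
  have "a * ln (a / b) \<ge> a * ((a / b - 1) * (5 * (a / b) + 1) / (2 * (a / b) * (a / b + 2)))"
    using a assms by (intro mult_left_mono ln_ge_rational) auto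
  also have "a * ((a / b - 1) * (5 * (a / b) + 1) / (2 * (a / b) * (a / b + 2)))
      = (a - b) * (5 * a + b) / (2 * (a + 2 * b))"
  proof -
    have "a / b - 1 = (a - b) / b" "5 * (a / b) + 1 = (5 * a + b) / b" "a / b + 2 = (a + 2 * b) / b"
      using assms by (auto simp: field_simps)
    then show ?thesis
      using a assms by simp
  qed
  also have "\<dots> = a - b + 3/2 * ((a - b)\<^sup>2 / (a + 2 * b))"
    using a assms by (simp add: divide_simps) (simp add: algebra_simps power2_eq_square)
  finally show ?thesis by simp
qed

theorem Pinsker:
  fixes p q :: "real ^ 'n::finite"
  assumes "p \<in> simplex_vectors" "q \<in> simplex_vectors" and q: "\<And>i. q $ i > 0"
  shows "1/2 * (\<Sum>i\<in>UNIV. \<bar>p $ i - q $ i\<bar>) \<le> sqrt (1/2 * kl p q)"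
proof (rule real_le_rsqrt)
  have p: "\<And>i. p $ i \<ge> 0" and sums: "(\<Sum>i\<in>UNIV. p $ i) = 1" "(\<Sum>i\<in>UNIV. q $ i) = 1"
    using assms by (auto simp: simplex_vectors_def)
  have pos: "p $ i + 2 * q $ i > 0" for i
    using p[of i] q[of i] by simp
  have "3/2 * (\<Sum>i\<in>UNIV. (p $ i - q $ i)\<^sup>2 / (p $ i + 2 * q $ i))
      \<le> (\<Sum>i\<in>UNIV. p $ i * ln (p $ i / q $ i) - p $ i + q $ i)"
    unfolding sum_distrib_left by (intro sum_mono kl_summand_ge p q)
  also have "\<dots> = kl p q"
    by (simp add: kl_def sum.distrib sum_subtractf sums)
  finally have kl: "3/2 * (\<Sum>i\<in>UNIV. (p $ i - q $ i)\<^sup>2 / (p $ i + 2 * q $ i)) \<le> kl p q" .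
  \<comment> \<open>Cauchy-Schwarz with weights p_i + 2 q_i, which are positive and of total 1 + 2 =
    3. If S is the weighted sum of squares, the squared l1 distance is at most 3 S, and 3/2 S \<le>
    \<open>kl p q\<close> bounds it by 2 \<open>kl p q\<close>; the factor 1/4 from squaring 1/2
    then gives the constant 1/2.\<close>
  have "(\<Sum>i\<in>UNIV. \<bar>p $ i - q $ i\<bar>)\<^sup>2
      = (\<Sum>i\<in>UNIV. \<bar>p $ i - q $ i\<bar> / sqrt (p $ i + 2 * q $ i) * sqrt (p $ i + 2 * q $ i))\<^sup>2"
    using pos by (simp add: less_imp_neq[THEN not_sym])
  also have "\<dots> \<le> (\<Sum>i\<in>UNIV. (\<bar>p $ i - q $ i\<bar> / sqrt (p $ i + 2 * q $ i))\<^sup>2)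
      * (\<Sum>i\<in>UNIV. (sqrt (p $ i + 2 * q $ i))\<^sup>2)"
    by (rule Cauchy_Schwarz_ineq_sum)
  also have "\<dots> = (\<Sum>i\<in>UNIV. (p $ i - q $ i)\<^sup>2 / (p $ i + 2 * q $ i)) * 3"
    using pos by (simp add: power_divide less_imp_le sum.distrib sums flip: sum_distrib_left)
  finally show "(1/2 * (\<Sum>i\<in>UNIV. \<bar>p $ i - q $ i\<bar>))\<^sup>2 \<le> 1/2 * kl p q"
    using kl by (simp add: power_divide)
qed

lemma edge_diff_le_total_variation:
  assumes "\<And>i. y i \<in> {-1, 1}" "\<And>z. h z \<in> {-1, 1}"
  shows "edge x y h p - edge x y h q \<le> 1/2 * (\<Sum>i\<in>UNIV. \<bar>p $ i - q $ i\<bar>)"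
proof -
  have "p $ i * y i * h (x i) - q $ i * y i * h (x i) \<le> \<bar>p $ i - q $ i\<bar>" for i
    using assms(1)[of i] assms(2)[of "x i"] by auto
  then have "(\<Sum>i\<in>UNIV. p $ i * y i * h (x i) - q $ i * y i * h (x i))
      \<le> (\<Sum>i\<in>UNIV. \<bar>p $ i - q $ i\<bar>)"
    by (intro sum_mono)
  then show ?thesis
    by (simp add: edge_def sum_subtractf)
qed

text \<open>Only the endpoint 0 is delicate: the factor u makes the value there 0, which agrees with
  the limit from the right.\<close>

lemma continuous_on_mult_ln: "continuous_on {0..} (\<lambda>u::real. u * ln u)"
  unfolding continuous_on_eq_continuous_within
proof
  fix u :: real assume "u \<in> {0..}"
  show "continuous (at u within {0..}) (\<lambda>u. u * ln u)"
  proof (cases "u = 0")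
    case True
    have "((\<lambda>u::real. u * ln u) \<longlongrightarrow> 0) (at_right 0)"
      by real_asymp
    then show ?thesis
      using True by (simp add: continuous_within at_within_Ici_at_right)
  next
    case False
    then show ?thesis
      by (intro continuous_intros)
  qed
qed

lemma continuous_on_kl:
  fixes q :: "real ^ 'n::finite"
  assumes q: "\<And>i. q $ i > 0"
  shows "continuous_on simplex_vectors (\<lambda>p. kl p q)"
proof -
  have "continuous_on simplex_vectors
      (\<lambda>p. \<Sum>i\<in>UNIV. p $ i * ln (p $ i) - p $ i * ln (q $ i))"
    by (intro continuous_intros continuous_on_compose2[OF continuous_on_mult_ln])
       (auto simp: simplex_vectors_def)
  moreover have "kl p q = (\<Sum>i\<in>UNIV. p $ i * ln (p $ i) - p $ i * ln (q $ i))"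
    if "p \<in> simplex_vectors" for p
    unfolding kl_def
  proof (intro sum.cong refl)
    fix i
    have "p $ i \<ge> 0"
      using that by (simp add: simplex_vectors_def)
    then show "p $ i * ln (p $ i / q $ i) = p $ i * ln (p $ i) - p $ i * ln (q $ i)"
      using q[of i] by (cases "p $ i = 0") (simp_all add: ln_div algebra_simps)
  qed
  ultimately show ?thesis
    by (simp cong: continuous_on_cong)
qed

lemma compact_simplex_vectors: "compact (simplex_vectors :: (real ^ 'n::finite) set)"
proof -
  have "norm p \<le> 1" if "p \<in> simplex_vectors" for p :: "real ^ 'n"
    using norm_le_l1_cart[of p] that by (simp add: simplex_vectors_def)
  then have "bounded (simplex_vectors :: (real ^ 'n) set)"
    by (auto intro: boundedI)
  moreover have "closed (simplex_vectors :: (real ^ 'n) set)"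
    unfolding simplex_vectors_def
    by (intro closed_Collect_conj closed_Collect_all closed_Collect_le closed_Collect_eq
        continuous_intros)
  ultimately show ?thesis
    by (simp add: compact_eq_bounded_closed)
qed

lemma compact_fairness_set: "compact (fairness_set K g \<epsilon>)"
proof -
  have "fairness_set K g \<epsilon> = simplex_vectors \<inter>
      (\<Inter>k\<in>{1..K}. {w. \<bar>\<Sum>i\<in>UNIV. w $ i * g k i\<bar> \<le> \<epsilon>})"
    by (auto simp: fairness_set_def)
  moreover have "closed (\<Inter>k\<in>{1..K}. {w. \<bar>\<Sum>i\<in>UNIV. w $ i * g k i\<bar> \<le> \<epsilon>})"
    by (intro closed_INT ballI closed_Collect_le continuous_intros)
  ultimately show ?thesis
    using compact_Int_closed[OF compact_simplex_vectors] by simp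
qed

text \<open>\<open>arg_min_on\<close> is a Hilbert choice, so it lies in \<open>S\<close> only once
  some minimizer is known to exist. Compactness and continuity supply one as the witness for
  \<open>someI\<close>.\<close>

lemma arg_min_on_in_compact:
  fixes f :: "'a::topological_space \<Rightarrow> real"
  assumes "compact S" "S \<noteq> {}" "continuous_on S f"
  shows "arg_min_on f S \<in> S"
proof -
  obtain v where "v \<in> S" "\<forall>u\<in>S. f v \<le> f u"
    using continuous_attains_inf[OF assms] by blast
  then have "is_arg_min f (\<lambda>v. v \<in> S) v"
    by (auto simp: is_arg_min_linorder)
  then have "is_arg_min f (\<lambda>v. v \<in> S) (arg_min_on f S)"
    unfolding arg_min_on_def arg_min_def by (rule someI)
  then show ?thesis
    by (simp add: is_arg_min_def)
qed

theorem corollary5p3: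
  fixes x :: "'n::finite \<Rightarrow> 'x"
    and y :: "'n \<Rightarrow> real"
    and \<alpha> :: "nat \<Rightarrow> real"
    and h :: "nat \<Rightarrow> 'x \<Rightarrow> real"
    and t K :: nat
    and g :: "nat \<Rightarrow> 'n \<Rightarrow> real"
    and \<epsilon> :: real
    and q w :: "real ^ 'n"
    and \<gamma>q \<gamma>w \<delta> :: real
  assumes "t \<ge> 1"
    and "\<And>i. y i \<in> {-1, 1}"
    and "\<And>s. s \<in> {1..<t} \<Longrightarrow> \<alpha> s > 0"
    and "\<And>s z. s \<in> {1..t} \<Longrightarrow> h s z \<in> {-1, 1}"
    and "\<And>k. k \<in> {1..K} \<Longrightarrow> bounded (range (g k))"
    and "\<epsilon> > 0"
    and "fairness_set K g \<epsilon> \<noteq> {}"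
    and "q = exp_weights x y (ensemble \<alpha> h (t - 1))"
    and "w = arg_min_on (\<lambda>v. kl v q) (fairness_set K g \<epsilon>)"
    and "\<gamma>w = edge x y (h t) w"
    and "\<gamma>q = edge x y (h t) q"
    and "\<delta> = sqrt (1/2 * kl w q)"
  shows "\<gamma>q \<ge> \<gamma>w - \<delta>"
proof -
  \<comment> \<open>Strict positivity of the exponential weights serves twice: for continuity of the
    divergence in its first argument and for Pinsker's inequality.\<close>
  have q: "q \<in> simplex_vectors" "\<And>i. q $ i > 0"
    using assms(8) by (auto simp: exp_weights_in_simplex exp_weights_pos)
  have "continuous_on (fairness_set K g \<epsilon>) (\<lambda>v. kl v q)"
    by (rule continuous_on_subset[OF continuous_on_kl[OF q(2)]]) (auto simp: fairness_set_def)
  then have "w \<in> fairness_set K g \<epsilon>"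
    unfolding assms(9) by (intro arg_min_on_in_compact compact_fairness_set assms(7))
  then have "w \<in> simplex_vectors"
    by (simp add: fairness_set_def)
  then have "1/2 * (\<Sum>i\<in>UNIV. \<bar>w $ i - q $ i\<bar>) \<le> \<delta>"
    unfolding assms(12) by (rule Pinsker[OF _ q])
  moreover have "\<gamma>w - \<gamma>q \<le> 1/2 * (\<Sum>i\<in>UNIV. \<bar>w $ i - q $ i\<bar>)"
    \<comment> \<open>\<open>t \<ge> 1\<close> puts t into {1..t}, so that \<open>h t\<close> takes
      values in {-1, 1}.\<close>
    unfolding assms(10,11) using assms(1,2,4) by (intro edge_diff_le_total_variation) auto
  ultimately show ?thesis
    by linarith
qed

end
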